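(* Let $b_0,b_1,\dots$ and $\lambda_1,\lambda_2,\dots$ be independent indeterminates and work in the field of rational functions in them. For all positive integers $k,m$ and every nonnegative integer $n$, \[ \det\left(\mu^{\le k+m-1}_{n+i+j+2m-2}(\mathbf{b},\boldsymbol{\lambda})\right)_{i,j=0}^{k-1} =\left(\prod_{i=1}^{k+m-1}\lambda_i^{k-i}\right)\left(\det A^{\le k+m-1}(\mathbf{b},\boldsymbol{\lambda})\right)^{n+2m-2} R^{(k+m-1)}\!\left(\det\left(\mu^{\le k+m-1}_{-n-i-j}(\mathbf{b},\boldsymbol{\lambda})\right)_{i,j=0}^{m-1}\right). \]
   Context: A Motzkin path is a finite sequence of points in $\mathbb{Z}\times\mathbb{Z}_{\ge0}$ whose steps are each $(1,1)$, $(1,0)$ or $(1,-1)$. Its weight is the product of $b_i$ over horizontal steps starting at height $i$ and of $\lambda_i$ over down steps starting at height $i$. $\mu^{\le K}_N(\mathbf{b},\boldsymbol{\lambda})$ ($N\ge0$) is the sum of weights of Motzkin paths from $(0,0)$ to $(N,0)$ staying weakly below $y=K$. Negative indices: if $(f_N)_{N\ge0}$ satisfies $f_N=c_1f_{N-1}+\cdots+c_df_{N-d}$ for all $N\ge d$ with $c_d\ne0$, it is extended uniquely to all $N\in\mathbb{Z}$ so that the recurrence holds for all $N$; $\mu^{\le K}_{-N}(\mathbf{b},\boldsymbol{\lambda})$ denotes this extension (it exists here). $A^{\le K}(\mathbf{b},\boldsymbol{\lambda})$ is the $(K+1)\times(K+1)$ tridiagonal matrix with rows and columns indexed by $0,\dots,K$,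 diagonal entries $b_0,\dots,b_K$, entries $1$ in positions $(i,i+1)$, and entry $\lambda_i$ in position $(i,i-1)$ for $1\le i\le K$, all other entries $0$. $R^{(N)}$ is the operator on rational functions in $b_0,\dots,b_N,\lambda_1,\dots,\lambda_N$ that replaces each $b_i$ by $b_{N-i}$ and each $\lambda_i$ by $\lambda_{N+1-i}$. *)

theory Defs
  imports
    "HOL-Library.Poly_Mapping"
    "HOL-Computational_Algebra.Fraction_Field"
    "Jordan_Normal_Form.Determinant"
begin

section \<open>Motzkin paths of bounded height\<close>

type_synonym point = "int \<times> nat"

definition motzkin_step :: "point \<Rightarrow> point \<Rightarrow> bool" where
  "motzkin_step p q \<longleftrightarrow> fst q = fst p + 1 \<and>
     (snd q = snd p + 1 \<or> snd q = snd p \<or> snd q + 1 = snd p)"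

definition motzkin_path :: "point list \<Rightarrow> bool" where
  "motzkin_path ps \<longleftrightarrow> ps \<noteq> [] \<and>
     (\<forall>t. Suc t < length ps \<longrightarrow> motzkin_step (ps ! t) (ps ! Suc t))"

definition step_weight ::
  "(nat \<Rightarrow> 'a::comm_ring_1) \<Rightarrow> (nat \<Rightarrow> 'a) \<Rightarrow> point \<Rightarrow> point \<Rightarrow> 'a" where
  "step_weight b l p q =
     (if snd q = snd p then b (snd p) else if snd q < snd p then l (snd p) else 1)"

definition path_weight ::
  "(nat \<Rightarrow> 'a::comm_ring_1) \<Rightarrow> (nat \<Rightarrow> 'a) \<Rightarrow> point list \<Rightarrow> 'a" where
  "path_weight b l ps = (\<Prod>t<length ps - 1. step_weight b l (ps ! t) (ps ! Suc t))"

definition bounded_paths :: "nat \<Rightarrow> nat \<Rightarrow> point list set" where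
  "bounded_paths K N = {ps. motzkin_path ps \<and> hd ps = (0, 0) \<and> last ps = (int N, 0) \<and>
     (\<forall>p\<in>set ps. snd p \<le> K)}"

definition moment ::
  "(nat \<Rightarrow> 'a::comm_ring_1) \<Rightarrow> (nat \<Rightarrow> 'a) \<Rightarrow> nat \<Rightarrow> nat \<Rightarrow> 'a" where
  "moment b l K N = (\<Sum>ps\<in>bounded_paths K N. path_weight b l ps)"

lemma motzkin_path_fst:
  assumes "motzkin_path ps" "t < length ps"
  shows "fst (ps ! t) = fst (hd ps) + int t"
  using assms(2)
proof (induction t)
  case 0
  then show ?case by (simp add: hd_conv_nth)
next
  case (Suc t)
  then show ?case using assms(1) by (auto simp: motzkin_path_def motzkin_step_def)
qed

text \<open>The sum defining \<open>moment\<close> ranges over a finite set, so it is not a junk value.\<close>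

lemma finite_bounded_paths: "finite (bounded_paths K N)"
proof (rule finite_subset)
  show "bounded_paths K N \<subseteq> {ps. set ps \<subseteq> {0..int N} \<times> {0..K} \<and> length ps = Suc N}"
  proof
    fix ps assume "ps \<in> bounded_paths K N"
    then have m: "motzkin_path ps" and h: "hd ps = (0, 0)" and e: "last ps = (int N, 0)"
      and K: "\<forall>p\<in>set ps. snd p \<le> K"
      by (auto simp: bounded_paths_def)
    from m have ne: "ps \<noteq> []" by (simp add: motzkin_path_def)
    from motzkin_path_fst[OF m, of "length ps - 1"] ne h e have len: "length ps = Suc N"
      by (cases "length ps") (auto simp: last_conv_nth)
    have "p \<in> {0..int N} \<times> {0..K}" if p: "p \<in> set ps" for p
    proof -
      from p obtain t where t: "t < length ps" "p = ps ! t" by (auto simp: in_set_conv_nth)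
      with motzkin_path_fst[OF m t(1)] h have "fst p = int t" by simp
      moreover have "snd p \<le> K" using K p by blast
      ultimately show ?thesis using t(1) len by (simp add: mem_Times_iff)
    qed
    then show "ps \<in> {ps. set ps \<subseteq> {0..int N} \<times> {0..K} \<and> length ps = Suc N}"
      using len by blast
  qed
  show "finite {ps. set ps \<subseteq> {0..int N} \<times> {0..K} \<and> length ps = Suc N}"
    by (rule finite_lists_length_eq) simp
qed

section \<open>Extension of linear recurrences to negative indices\<close>

definition linear_recurrence :: "nat \<Rightarrow> (nat \<Rightarrow> 'a::field) \<Rightarrow> (int \<Rightarrow> 'a) \<Rightarrow> bool" where
  "linear_recurrence d c g \<longleftrightarrow> (\<forall>N. g N = (\<Sum>i=1..d. c i * g (N - int i)))"

definition is_extension :: "(nat \<Rightarrow> 'a::field) \<Rightarrow> (int \<Rightarrow> 'a) \<Rightarrow> bool" where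
  "is_extension f g \<longleftrightarrow> (\<forall>N. g (int N) = f N) \<and>
     (\<exists>d c. d \<ge> 1 \<and> c d \<noteq> 0 \<and> linear_recurrence d c g)"

definition extension :: "(nat \<Rightarrow> 'a::field) \<Rightarrow> int \<Rightarrow> 'a" where
  "extension f = (THE g. is_extension f g)"

text \<open>
  An extension is unique, even across different recurrences satisfied by the same sequence,
  so \<open>extension f\<close> is meaningful whenever \<open>f\<close> has some extension.
\<close>

lemma linear_recurrence_eq_0:
  assumes rec: "linear_recurrence d c g" and d: "d \<ge> 1" "c d \<noteq> 0"
    and z: "\<And>N. N \<ge> M \<Longrightarrow> g N = 0"
  shows "g N = 0"
proof -
  have "\<forall>N \<ge> M - int k. g N = 0" for k
  proof (induction k)
    case 0
    then show ?case using z by simp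
  next
    case (Suc k)
    then have IH: "g N = 0" if "N \<ge> M - int k" for N using that by blast
    have "g (M - int (Suc k)) = 0"
    proof -
      define N where "N = M - int (Suc k) + int d"
      have "g N = (\<Sum>i=1..d. c i * g (N - int i))"
        using rec unfolding linear_recurrence_def by blast
      also have "\<dots> = c d * g (N - int d) + (\<Sum>i\<in>{1..d} - {d}. c i * g (N - int i))"
        using d by (subst sum.remove[of _ d]) auto
      also have "(\<Sum>i\<in>{1..d} - {d}. c i * g (N - int i)) = 0"
        by (rule sum.neutral) (auto simp: N_def intro!: IH)
      finally have "g N = c d * g (N - int d)" by simp
      moreover have "g N = 0" by (rule IH) (use d in \<open>simp add: N_def\<close>)
      ultimately have "g (N - int d) = 0" using d by simp
      then show ?thesis by (simp add: N_def)
    qed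
    moreover have "N \<ge> M - int k" if "N \<ge> M - int (Suc k)" "N \<noteq> M - int (Suc k)" for N
      using that by simp
    ultimately show ?case using IH by metis
  qed
  moreover have "N \<ge> M - int (nat (M - N))" by simp
  ultimately show ?thesis by blast
qed

lemma is_extension_unique:
  assumes "is_extension f g" "is_extension f h"
  shows "g = h"
proof -
  from assms obtain d c d' c' where
    g: "d \<ge> 1" "c d \<noteq> 0" "linear_recurrence d c g" and
    h: "d' \<ge> 1" "c' d' \<noteq> 0" "linear_recurrence d' c' h"
    unfolding is_extension_def by blast
  define u where "u N = g N - (\<Sum>j=1..d'. c' j * g (N - int j))" for N
  define w where "w N = g N - h N" for N
  have w0: "w N = 0" if "N \<ge> 0" for N
  proof -
    from that obtain n where "N = int n" using nonneg_int_cases by blast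
    then show ?thesis using assms by (simp add: w_def is_extension_def)
  qed
  have uw: "u N = w N - (\<Sum>j=1..d'. c' j * w (N - int j))" for N
  proof -
    have "h N = (\<Sum>j=1..d'. c' j * h (N - int j))"
      using h(3) unfolding linear_recurrence_def by blast
    moreover have "(\<Sum>j=1..d'. c' j * w (N - int j)) =
      (\<Sum>j=1..d'. c' j * g (N - int j)) - (\<Sum>j=1..d'. c' j * h (N - int j))"
      by (simp add: w_def right_diff_distrib sum_subtractf)
    moreover have "a - x = a - y - (x - y)" for a x y :: 'a by simp
    ultimately show ?thesis unfolding u_def by (simp only: w_def[of N])
  qed
  have "linear_recurrence d c u"
    unfolding linear_recurrence_def
  proof
    fix N
    have gr: "g M = (\<Sum>i=1..d. c i * g (M - int i))" for M
      using g(3) unfolding linear_recurrence_def by blast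
    have "(\<Sum>i=1..d. c i * u (N - int i)) =
      (\<Sum>i=1..d. c i * g (N - int i)) -
      (\<Sum>i=1..d. \<Sum>j=1..d'. c i * (c' j * g (N - int i - int j)))"
      by (simp add: u_def right_diff_distrib sum_subtractf sum_distrib_left)
    also have "(\<Sum>i=1..d. \<Sum>j=1..d'. c i * (c' j * g (N - int i - int j))) =
      (\<Sum>j=1..d'. \<Sum>i=1..d. c' j * (c i * g (N - int j - int i)))"
      by (subst sum.swap, intro sum.cong refl) (simp add: algebra_simps)
    also have "\<dots> = (\<Sum>j=1..d'. c' j * (\<Sum>i=1..d. c i * g (N - int j - int i)))"
      by (simp only: sum_distrib_left)
    also have "\<dots> = (\<Sum>j=1..d'. c' j * g (N - int j))" by (simp only: gr[symmetric])
    finally show "u N = (\<Sum>i=1..d. c i * u (N - int i))"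
      by (simp only: u_def[of N] gr[of N, symmetric])
  qed
  moreover have "u N = 0" if "N \<ge> int d'" for N
    unfolding uw using that by (simp add: w0)
  ultimately have u0: "u N = 0" for N
    by (rule linear_recurrence_eq_0[where d = d and c = c, OF _ g(1,2)])
  have "linear_recurrence d' c' w"
    unfolding linear_recurrence_def
  proof
    fix N
    have "w N - (\<Sum>j=1..d'. c' j * w (N - int j)) = 0"
      using uw[of N, symmetric] u0[of N] by (rule trans)
    then show "w N = (\<Sum>j=1..d'. c' j * w (N - int j))" by (rule right_minus_eq[THEN iffD1])
  qed
  then have "w N = 0" for N
    by (rule linear_recurrence_eq_0[where d = d' and c = c', OF _ h(1,2) w0])
  then have "g N = h N" for N
    unfolding w_def by (rule right_minus_eq[THEN iffD1])
  then show ?thesis by (rule ext)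
qed

lemma extension_eqI: "is_extension f g \<Longrightarrow> extension f = g"
  unfolding extension_def by (rule the_equality) (auto intro: is_extension_unique)

definition moment_int ::
  "(nat \<Rightarrow> 'a::field) \<Rightarrow> (nat \<Rightarrow> 'a) \<Rightarrow> nat \<Rightarrow> int \<Rightarrow> 'a" where
  "moment_int b l K = extension (moment b l K)"

section \<open>The tridiagonal matrix\<close>

definition tridiag :: "(nat \<Rightarrow> 'a::comm_ring_1) \<Rightarrow> (nat \<Rightarrow> 'a) \<Rightarrow> nat \<Rightarrow> 'a mat" where
  "tridiag b l K = mat (K + 1) (K + 1) (\<lambda>(i, j).
     if j = i then b i else if j = i + 1 then 1 else if i = j + 1 then l i else 0)"

section \<open>Rational functions in the indeterminates\<close>

text \<open>
  The type \<open>'a ratfun\<close> is the field of rational functions over \<open>'a\<close> in indeterminates indexed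
  by \<open>nat\<close>.  The indeterminates $b_i$ ($i \ge 0$) and $\lambda_i$ ($i \ge 1$) are the ones with
  index \<open>2 * i\<close> and \<open>2 * i - 1\<close>; this enumerates all of \<open>nat\<close> exactly once.  The value
  \<open>lvar 0\<close> is meaningless and never used.
\<close>

type_synonym 'a mpoly = "(nat \<Rightarrow>\<^sub>0 nat) \<Rightarrow>\<^sub>0 'a"
type_synonym 'a ratfun = "'a mpoly fract"

definition indet :: "nat \<Rightarrow> 'a::field ratfun" where
  "indet v = Fract (Poly_Mapping.single (Poly_Mapping.single v 1) 1) 1"

definition bvar :: "nat \<Rightarrow> 'a::field ratfun" where
  "bvar i = indet (2 * i)"

definition lvar :: "nat \<Rightarrow> 'a::field ratfun" where
  "lvar i = indet (2 * i - 1)"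

text \<open>
  In terms of indices, $b_0,\dots,b_N,\lambda_1,\dots,\lambda_N$ are exactly those in
  \<open>{0..2 * N}\<close>, and both $b_i \mapsto b_{N-i}$ and $\lambda_i \mapsto \lambda_{N+1-i}$ become
  \<open>v \<mapsto> 2 * N - v\<close>.  The remaining indeterminates are left alone.  Since \<open>flip N\<close> is an
  involution, precomposing exponents and monomials with it renames the indeterminates by it.
\<close>

definition flip :: "nat \<Rightarrow> nat \<Rightarrow> nat" where
  "flip N v = (if v \<le> 2 * N then 2 * N - v else v)"

definition flip_mpoly :: "nat \<Rightarrow> 'a::field mpoly \<Rightarrow> 'a mpoly" where
  "flip_mpoly N p = Poly_Mapping.map_key (Poly_Mapping.map_key (flip N)) p"

lemma flip_flip [simp]: "flip N (flip N v) = v"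
  by (simp add: flip_def)

lemma flip_flip_comp: "flip N \<circ> flip N = (\<lambda>v. v)"
  by (simp add: fun_eq_iff)

lemma inj_flip: "inj (flip N)"
  by (rule inj_on_inverseI[of _ "flip N"]) simp

abbreviation flip_monom :: "nat \<Rightarrow> (nat \<Rightarrow>\<^sub>0 nat) \<Rightarrow> (nat \<Rightarrow>\<^sub>0 nat)" where
  "flip_monom N \<equiv> Poly_Mapping.map_key (flip N)"

lemma flip_monom_flip_monom [simp]: "flip_monom N (flip_monom N x) = x"
  by (simp add: map_key_compose[OF inj_flip inj_flip] flip_flip_comp map_key_id)

lemma inj_flip_monom: "inj (flip_monom N)"
  by (rule inj_on_inverseI[of _ "flip_monom N"]) simp

lemma flip_monom_plus: "flip_monom N (x + y) = flip_monom N x + flip_monom N y"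
  by (rule map_key_plus[OF inj_flip])

lemma flip_mpoly_plus: "flip_mpoly N (p + q) = flip_mpoly N p + flip_mpoly N q"
  unfolding flip_mpoly_def by (rule map_key_plus[OF inj_flip_monom])

lemma flip_mpoly_0 [simp]: "flip_mpoly N 0 = 0"
  unfolding flip_mpoly_def by (rule map_key_zero[OF inj_flip_monom])

lemma flip_mpoly_flip_mpoly [simp]: "flip_mpoly N (flip_mpoly N p) = p"
proof -
  have "flip_monom N \<circ> flip_monom N = (\<lambda>x. x)" by (simp add: fun_eq_iff)
  then show ?thesis
    unfolding flip_mpoly_def
    by (simp add: map_key_compose[OF inj_flip_monom inj_flip_monom] map_key_id)
qed

lemma flip_mpoly_eq_0_iff [simp]: "flip_mpoly N p = 0 \<longleftrightarrow> p = 0"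
  by (metis flip_mpoly_0 flip_mpoly_flip_mpoly)

lemma flip_mpoly_single:
  "flip_mpoly N (Poly_Mapping.single x c) = Poly_Mapping.single (flip_monom N x) c"
  unfolding flip_mpoly_def
  using map_key_single[OF inj_flip_monom, of N "flip_monom N x" c] by simp

lemma mpoly_sum_induct [case_names zero single add]:
  fixes p :: "'a::field mpoly"
  assumes "P 0" "\<And>x c. P (Poly_Mapping.single x c)" "\<And>p q. P p \<Longrightarrow> P q \<Longrightarrow> P (p + q)"
  shows "P p"
proof (induction p rule: update_induct)
  case const
  then show ?case by (rule assms(1))
next
  case (update f a c)
  then have "Poly_Mapping.update a c f = f + Poly_Mapping.single a c"
    by (intro poly_mapping_eqI)
       (auto simp: lookup_update lookup_add lookup_single in_keys_iff when_def)
  then show ?case using assms update by simp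
qed

lemma flip_mpoly_single_times:
  "flip_mpoly N (Poly_Mapping.single x c * q) =
     flip_mpoly N (Poly_Mapping.single x c) * flip_mpoly N q"
  by (induction q rule: mpoly_sum_induct)
     (simp_all add: flip_mpoly_single mult_single flip_monom_plus flip_mpoly_plus distrib_left)

lemma flip_mpoly_times: "flip_mpoly N (p * q) = flip_mpoly N p * flip_mpoly N q"
  by (induction p rule: mpoly_sum_induct)
     (simp_all add: flip_mpoly_single_times flip_mpoly_plus distrib_right)

lemma flip_mpoly_1: "flip_mpoly N 1 = 1"
proof -
  have "flip_monom N 0 = 0" by (rule map_key_zero[OF inj_flip])
  then show ?thesis by (simp add: flip_mpoly_single flip: single_one)
qed

definition R_op :: "nat \<Rightarrow> 'a::field ratfun \<Rightarrow> 'a ratfun" where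
  "R_op N r = (THE s. \<exists>p q. q \<noteq> 0 \<and> r = Fract p q \<and> s = Fract (flip_mpoly N p) (flip_mpoly N q))"

lemma R_op_Fract:
  assumes "q \<noteq> 0"
  shows "R_op N (Fract p q) = Fract (flip_mpoly N p) (flip_mpoly N q)"
  unfolding R_op_def
proof (rule the_equality)
  fix s
  assume "\<exists>p' q'. q' \<noteq> 0 \<and> Fract p q = Fract p' q' \<and> s = Fract (flip_mpoly N p') (flip_mpoly N q')"
  then obtain p' q' where *: "q' \<noteq> 0" "Fract p q = Fract p' q'"
    "s = Fract (flip_mpoly N p') (flip_mpoly N q')" by (elim exE conjE)
  then have "p * q' = p' * q" using eq_fract(1)[OF assms, of q' p p'] by blast
  then have "flip_mpoly N p * flip_mpoly N q' = flip_mpoly N p' * flip_mpoly N q"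
    by (simp only: flip_mpoly_times[symmetric])
  moreover have "flip_mpoly N q \<noteq> 0" "flip_mpoly N q' \<noteq> 0" using assms *(1) by simp_all
  ultimately have "Fract (flip_mpoly N p) (flip_mpoly N q) = Fract (flip_mpoly N p') (flip_mpoly N q')"
    by (intro eq_fract(1)[THEN iffD2])
  then show "s = Fract (flip_mpoly N p) (flip_mpoly N q)" unfolding *(3) by (rule sym)
next
  show "\<exists>p' q'. q' \<noteq> 0 \<and> Fract p q = Fract p' q' \<and>
      Fract (flip_mpoly N p) (flip_mpoly N q) = Fract (flip_mpoly N p') (flip_mpoly N q')"
    by (rule exI[of _ p], rule exI[of _ q], rule conjI[OF assms conjI[OF refl refl]])
qed

lemma R_op_indet: "R_op N (indet v) = indet (flip N v)"
proof -
  have "flip_monom N (Poly_Mapping.single v 1) = Poly_Mapping.single (flip N v) 1"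
    using map_key_single[OF inj_flip, of N "flip N v" "1::nat"] by simp
  then show ?thesis unfolding indet_def R_op_Fract[OF one_neq_zero] flip_mpoly_single flip_mpoly_1
    by (simp only:)
qed

lemma R_op_bvar: "i \<le> N \<Longrightarrow> R_op N (bvar i) = bvar (N - i)"
proof -
  assume "i \<le> N"
  then have "flip N (2 * i) = 2 * (N - i)" by (simp add: flip_def diff_mult_distrib2)
  then show ?thesis unfolding bvar_def R_op_indet by (simp only:)
qed

lemma R_op_lvar: "1 \<le> i \<Longrightarrow> i \<le> N \<Longrightarrow> R_op N (lvar i) = lvar (N + 1 - i)"
proof -
  assume i: "1 \<le> i" "i \<le> N"
  then have "flip N (2 * i - 1) = 2 * N - (2 * i - 1)" by (simp add: flip_def)
  also have "\<dots> = 2 * (N + 1 - i) - 1" using i by linarith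
  finally have "flip N (2 * i - 1) = 2 * (N + 1 - i) - 1" .
  then show ?thesis unfolding lvar_def R_op_indet by (simp only:)
qed

lemma R_op_add: "R_op N (x + y) = R_op N x + R_op N y"
proof -
  obtain p q where x: "x = Fract p q" "q \<noteq> 0" by (cases x)
  obtain r s where y: "y = Fract r s" "s \<noteq> 0" by (cases y)
  show ?thesis using x(2) y(2) unfolding x(1) y(1)
    by (simp only: add_fract R_op_Fract flip_mpoly_plus flip_mpoly_times flip_mpoly_eq_0_iff
        mult_eq_0_iff de_Morgan_disj simp_thms)
qed

lemma R_op_mult: "R_op N (x * y) = R_op N x * R_op N y"
proof -
  obtain p q where x: "x = Fract p q" "q \<noteq> 0" by (cases x)
  obtain r s where y: "y = Fract r s" "s \<noteq> 0" by (cases y)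
  show ?thesis using x(2) y(2) unfolding x(1) y(1)
    by (simp only: mult_fract R_op_Fract flip_mpoly_times
        mult_eq_0_iff de_Morgan_disj simp_thms)
qed

lemma R_op_const: "R_op N (Fract (Poly_Mapping.single 0 c) 1) = Fract (Poly_Mapping.single 0 c) 1"
proof -
  have "flip_monom N 0 = 0" by (rule map_key_zero[OF inj_flip])
  then show ?thesis unfolding R_op_Fract[OF one_neq_zero] flip_mpoly_single flip_mpoly_1
    by (simp only:)
qed

end

(* Let A be the tridiagonal matrix, of size k + m. The moment of index N, positive or negative, is
   the (0, 0) entry of A^N. The first row of A^i vanishes beyond position i, where it is 1, and the
   first column of A^i vanishes beyond position i, where it is lambda_1 ... lambda_i. Hence the
   left determinant is a monomial times the leading k-minor of A^(n + 2m - 2), and the right one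
   is a monomial times the leading m-minor of A^(-(n + 2m - 2)). Jacobi's complementary minor
   formula turns the former minor into the trailing m-minor of the inverse power, and this is R of the
   leading one, because reversing both index ranges and applying R transposes A. *)
theory Submission
  imports Defs
begin

section \<open>Products, powers and inverses of square matrices\<close>

lemma index_mult_mat_sum:
  assumes "X \<in> carrier_mat n p" "Y \<in> carrier_mat p q" "i < n" "j < q"
  shows "(X * Y) $$ (i, j) = (\<Sum>a<p. X $$ (i, a) * Y $$ (a, j))"
  using assms by (auto simp: scalar_prod_def atLeast0LessThan intro!: sum.cong)

lemma pow_mat_Suc_left:
  assumes "A \<in> carrier_mat n n"
  shows "A ^\<^sub>m Suc t = A * A ^\<^sub>m t"
proof (induction t)
  case 0
  then show ?case using assms by simp
next
  case (Suc t)
  have "A ^\<^sub>m Suc (Suc t) = A * A ^\<^sub>m t * A" using Suc by simp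
  also have "\<dots> = A * A ^\<^sub>m Suc t" using assms by (simp add: assoc_mult_mat[of _ n n _ n _ n])
  finally show ?case .
qed

lemma det_pow_mat:
  fixes A :: "'a::comm_ring_1 mat"
  assumes "A \<in> carrier_mat n n"
  shows "det (A ^\<^sub>m t) = det A ^ t"
  using assms by (induction t) (auto simp: det_mult[of _ n] mult.commute)

lemma pow_mat_inverse:
  fixes A B :: "'a::comm_ring_1 mat"
  assumes A: "A \<in> carrier_mat n n" and B: "B \<in> carrier_mat n n" and AB: "A * B = 1\<^sub>m n"
  shows "A ^\<^sub>m t * B ^\<^sub>m t = 1\<^sub>m n"
proof (induction t)
  case 0
  then show ?case using assms by simp
next
  case (Suc t)
  have "A ^\<^sub>m Suc t * B ^\<^sub>m Suc t = A ^\<^sub>m t * (A * (B * B ^\<^sub>m t))"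
    unfolding pow_mat_Suc_left[OF B] using A B by (simp add: assoc_mult_mat[of _ n n _ n _ n])
  also have "A * (B * B ^\<^sub>m t) = B ^\<^sub>m t"
    using A B AB by (simp add: assoc_mult_mat[of A n n B n "B ^\<^sub>m t" n, symmetric])
  finally show ?case using Suc by simp
qed

lemma ex_inverse_mat:
  fixes A :: "'a::field mat"
  assumes "A \<in> carrier_mat n n" "det A \<noteq> 0"
  obtains B where "B \<in> carrier_mat n n" "A * B = 1\<^sub>m n" "B * A = 1\<^sub>m n"
proof -
  have "A \<in> Units (ring_mat TYPE('a) n ())" by (rule det_non_zero_imp_unit[OF assms])
  then show ?thesis using that by (auto simp: Units_def ring_mat_def)
qed

subsection \<open>Integer powers of an invertible matrix\<close>

text \<open>\<open>B\<close> stands for the inverse of \<open>A\<close>; passing it as an argument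
  gives negative powers without an inverse operation on matrices.\<close>

definition zpow_mat :: "'a::semiring_1 mat \<Rightarrow> 'a mat \<Rightarrow> int \<Rightarrow> 'a mat" where
  "zpow_mat A B N = (if N \<ge> 0 then A ^\<^sub>m nat N else B ^\<^sub>m nat (- N))"

lemma zpow_mat_of_nat [simp]: "zpow_mat A B (int t) = A ^\<^sub>m t"
  by (simp add: zpow_mat_def)

text \<open>At exponent 0 the definition returns a power of \<open>A\<close>; the common dimension
  makes this identity matrix the zeroth power of \<open>B\<close> as well.\<close>

lemma zpow_mat_minus_of_nat:
  assumes "A \<in> carrier_mat n n" "B \<in> carrier_mat n n"
  shows "zpow_mat A B (- int t) = B ^\<^sub>m t"
  using assms by (cases "t = 0") (auto simp: zpow_mat_def)

context
  fixes A B :: "'a::comm_ring_1 mat" and n :: nat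
  assumes A: "A \<in> carrier_mat n n" and B: "B \<in> carrier_mat n n"
    and AB: "A * B = 1\<^sub>m n" and BA: "B * A = 1\<^sub>m n"
begin

lemma zpow_mat_carrier [simp]: "zpow_mat A B N \<in> carrier_mat n n"
  using A B by (simp add: zpow_mat_def)

lemma zpow_mat_Suc:
  "zpow_mat A B (N + 1) = A * zpow_mat A B N" "zpow_mat A B (N + 1) = zpow_mat A B N * A"
proof -
  have "zpow_mat A B (N + 1) = A * zpow_mat A B N \<and> zpow_mat A B (N + 1) = zpow_mat A B N * A"
  proof (cases "N \<ge> 0")
    case True
    then obtain t where t: "N = int t" using nonneg_int_cases by blast
    have "zpow_mat A B (int t + 1) = A ^\<^sub>m Suc t"
      using zpow_mat_of_nat[of A B "Suc t"] by (simp add: add.commute)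
    then show ?thesis using pow_mat_Suc_left[OF A, of t] by (simp add: t)
  next
    case False
    \<comment> \<open>For negative \<open>N\<close>, one of the t + 1 factors \<open>B\<close>
      cancels against \<open>A\<close> on either side and leaves B^t.\<close>
    define t where "t = nat (- N - 1)"
    have N: "N = - int (Suc t)" using False by (simp add: t_def)
    have "A * B ^\<^sub>m Suc t = B ^\<^sub>m t"
      unfolding pow_mat_Suc_left[OF B]
      using A B AB by (simp add: assoc_mult_mat[of A n n B n "B ^\<^sub>m t" n, symmetric])
    moreover have "B ^\<^sub>m Suc t * A = B ^\<^sub>m t"
      using A B BA by (simp add: assoc_mult_mat[of "B ^\<^sub>m t" n n B n A n])
    moreover have "N + 1 = - int t" using N by simp
    ultimately show ?thesis
      by (metis N zpow_mat_minus_of_nat[OF A B])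
  qed
  then show "zpow_mat A B (N + 1) = A * zpow_mat A B N"
    "zpow_mat A B (N + 1) = zpow_mat A B N * A" by blast+
qed

lemma zpow_mat_add_left: "zpow_mat A B (N + int t) = A ^\<^sub>m t * zpow_mat A B N"
proof (induction t)
  case 0
  then show ?case using A left_mult_one_mat[OF zpow_mat_carrier[of N]] by simp
next
  case (Suc t)
  have "zpow_mat A B (N + int (Suc t)) = A * (A ^\<^sub>m t * zpow_mat A B N)"
    using zpow_mat_Suc(1)[of "N + int t"] Suc by (simp add: algebra_simps)
  also have "\<dots> = A ^\<^sub>m Suc t * zpow_mat A B N"
    unfolding pow_mat_Suc_left[OF A] using A
    by (simp add: assoc_mult_mat[of A n n "A ^\<^sub>m t" n "zpow_mat A B N" n])
  finally show ?case .
qed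

lemma zpow_mat_add_right: "zpow_mat A B (N + int t) = zpow_mat A B N * A ^\<^sub>m t"
proof (induction t)
  case 0
  then show ?case using A right_mult_one_mat[OF zpow_mat_carrier[of N]] by simp
next
  case (Suc t)
  have "zpow_mat A B (N + int (Suc t)) = zpow_mat A B N * A ^\<^sub>m t * A"
    using zpow_mat_Suc(2)[of "N + int t"] Suc by (simp add: algebra_simps)
  also have "\<dots> = zpow_mat A B N * A ^\<^sub>m Suc t"
    using A by (simp add: assoc_mult_mat[of "zpow_mat A B N" n n "A ^\<^sub>m t" n A n])
  finally show ?case .
qed

text \<open>Splits a Hankel entry of index N + i + j, so that the row index acts from the left and
  the column index from the right. The base exponent \<open>N\<close> may be negative, hence
  nonnegative shifts suffice.\<close>

lemma zpow_mat_add_both: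
  "zpow_mat A B (N + int i + int j) = A ^\<^sub>m i * zpow_mat A B N * A ^\<^sub>m j"
  using zpow_mat_add_right[of "N + int i" j] zpow_mat_add_left[of N i] by (simp only:)

end

subsection \<open>The first row and column of powers of the tridiagonal matrix\<close>

lemma tridiag_carrier [simp]: "tridiag b l K \<in> carrier_mat (Suc K) (Suc K)"
  by (simp add: tridiag_def)

lemma tridiag_index:
  "i \<le> K \<Longrightarrow> j \<le> K \<Longrightarrow> tridiag b l K $$ (i, j) =
     (if j = i then b i else if j = Suc i then 1 else if i = Suc j then l i else 0)"
  by (simp add: tridiag_def)

text \<open>In path terms: t steps from height 0 reach at most height t, and reach it only by up
  steps, each of weight 1.\<close>

lemma tridiag_pow_row:
  "j \<le> K \<Longrightarrow> t \<le> j \<Longrightarrow> (tridiag b l K ^\<^sub>m t) $$ (0, j) = (if j = t then 1 else 0)"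
proof (induction t arbitrary: j)
  case 0
  then show ?case by (auto simp: tridiag_def)
next
  case (Suc t)
  let ?A = "tridiag b l K"
  have "(?A ^\<^sub>m Suc t) $$ (0, j) = (\<Sum>a<Suc K. (?A ^\<^sub>m t) $$ (0, a) * ?A $$ (a, j))"
    using Suc.prems
    by (simp only: pow_mat.simps)
       (rule index_mult_mat_sum[of _ "Suc K" "Suc K" _ "Suc K"], simp_all)
  \<comment> \<open>Beyond t the row of A^t vanishes by induction; for a < t the entry (a, j) lies
    above the superdiagonal, because j > t.\<close>
  also have "\<dots> = (\<Sum>a<Suc K. if a = t then ?A $$ (t, j) else 0)"
  proof (intro sum.cong refl)
    fix a assume "a \<in> {..<Suc K}"
    then show "(?A ^\<^sub>m t) $$ (0, a) * ?A $$ (a, j) = (if a = t then ?A $$ (t, j) else 0)"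
      using Suc.prems Suc.IH[of a] by (cases "a < t") (auto simp: tridiag_index)
  qed
  also have "\<dots> = (if j = Suc t then 1 else 0)" using Suc.prems by (auto simp: tridiag_index)
  finally show ?case .
qed

text \<open>A descent from height t to 0 in t steps uses down steps only, of weights lambda_t, ...,
  lambda_1. The induction peels off the first step, hence a factor on the left.\<close>

lemma tridiag_pow_col:
  "j \<le> K \<Longrightarrow> t \<le> j \<Longrightarrow> (tridiag b l K ^\<^sub>m t) $$ (j, 0) = (if j = t then \<Prod>i=1..t. l i else 0)"
proof (induction t arbitrary: j)
  case 0
  then show ?case by (auto simp: tridiag_def)
next
  case (Suc t)
  let ?A = "tridiag b l K"
  have "(?A ^\<^sub>m Suc t) $$ (j, 0) = (\<Sum>a<Suc K. ?A $$ (j, a) * (?A ^\<^sub>m t) $$ (a, 0))"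
    using Suc.prems
    by (simp only: pow_mat_Suc_left[OF tridiag_carrier])
       (rule index_mult_mat_sum[of _ "Suc K" "Suc K" _ "Suc K"], simp_all)
  also have "\<dots> = (\<Sum>a<Suc K. if a = t then ?A $$ (j, t) * (\<Prod>i=1..t. l i) else 0)"
  proof (intro sum.cong refl)
    fix a assume "a \<in> {..<Suc K}"
    then show "?A $$ (j, a) * (?A ^\<^sub>m t) $$ (a, 0) =
        (if a = t then ?A $$ (j, t) * (\<Prod>i=1..t. l i) else 0)"
      using Suc.prems Suc.IH[of a] by (cases "a < t") (auto simp: tridiag_index)
  qed
  also have "\<dots> = (if j = Suc t then \<Prod>i=1..Suc t. l i else 0)"
    using Suc.prems by (auto simp: tridiag_index mult.commute)
  finally show ?case .
qed

subsection \<open>Moments as matrix entries\<close>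

text \<open>The end height is left free so that paths can be built by appending steps;
  \<open>h = 0\<close> gives back \<open>bounded_paths\<close>.\<close>

definition bounded_paths_to :: "nat \<Rightarrow> nat \<Rightarrow> nat \<Rightarrow> point list set" where
  "bounded_paths_to K N h = {ps. motzkin_path ps \<and> hd ps = (0, 0) \<and> last ps = (int N, h) \<and>
     (\<forall>p\<in>set ps. snd p \<le> K)}"

lemma length_bounded_paths_to:
  assumes "ps \<in> bounded_paths_to K N h"
  shows "length ps = Suc N"
proof -
  have ne: "ps \<noteq> []" and m: "motzkin_path ps" and "hd ps = (0, 0)" "last ps = (int N, h)"
    using assms by (auto simp: bounded_paths_to_def motzkin_path_def)
  with motzkin_path_fst[OF m, of "length ps - 1"] show ?thesis
    by (cases "length ps") (auto simp: last_conv_nth)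
qed

lemma finite_bounded_paths_to: "finite (bounded_paths_to K N h)"
proof (rule finite_subset)
  show "bounded_paths_to K N h \<subseteq> {ps. set ps \<subseteq> {0..int N} \<times> {0..K} \<and> length ps = Suc N}"
  proof
    fix ps assume ps: "ps \<in> bounded_paths_to K N h"
    note len = length_bounded_paths_to[OF this]
    have "p \<in> {0..int N} \<times> {0..K}" if p: "p \<in> set ps" for p
    proof -
      from p obtain t where t: "t < length ps" "p = ps ! t" by (auto simp: in_set_conv_nth)
      with ps p len motzkin_path_fst[of ps t] show ?thesis
        by (auto simp: bounded_paths_to_def mem_Times_iff)
    qed
    then show "ps \<in> {ps. set ps \<subseteq> {0..int N} \<times> {0..K} \<and> length ps = Suc N}"
      using len by blast
  qed
  show "finite {ps. set ps \<subseteq> {0..int N} \<times> {0..K} \<and> length ps = Suc N}"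
    by (rule finite_lists_length_eq) simp
qed

lemma motzkin_path_snoc:
  assumes "ps \<noteq> []"
  shows "motzkin_path (ps @ [q]) \<longleftrightarrow> motzkin_path ps \<and> motzkin_step (last ps) q"
proof
  assume *: "motzkin_path (ps @ [q])"
  have "motzkin_step (ps ! t) (ps ! Suc t)" if "Suc t < length ps" for t
    using * that unfolding motzkin_path_def
    by (metis Suc_lessD append_is_Nil_conv length_append_singleton less_SucI nth_append)
  moreover have "motzkin_step (last ps) q"
    using *[unfolded motzkin_path_def, THEN conjunct2, rule_format, of "length ps - 1"] assms
    by (simp add: nth_append last_conv_nth)
  ultimately show "motzkin_path ps \<and> motzkin_step (last ps) q"
    using assms by (simp add: motzkin_path_def)
next
  assume *: "motzkin_path ps \<and> motzkin_step (last ps) q"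
  have "motzkin_step ((ps @ [q]) ! t) ((ps @ [q]) ! Suc t)" if "Suc t < length (ps @ [q])" for t
  proof (cases "Suc t < length ps")
    case True
    then show ?thesis using * by (simp add: motzkin_path_def nth_append)
  next
    case False
    then have "t = length ps - 1" using that by simp
    then show ?thesis using * assms by (simp add: nth_append last_conv_nth)
  qed
  then show "motzkin_path (ps @ [q])" by (simp add: motzkin_path_def)
qed

lemma path_weight_snoc:
  assumes "ps \<noteq> []"
  shows "path_weight b l (ps @ [q]) = path_weight b l ps * step_weight b l (last ps) q"
proof -
  obtain n where n: "length ps = Suc n" using assms by (cases "length ps") auto
  show ?thesis using assms by (simp add: path_weight_def n nth_append last_conv_nth)
qed

text \<open>Sorts the paths by the height \<open>h'\<close> before the last step. The pieces are
  disjoint, since \<open>h'\<close> can be read off the last but one point.\<close>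

lemma bounded_paths_to_Suc:
  assumes "h \<le> K"
  shows "bounded_paths_to K (Suc N) h =
    (\<Union>h'\<in>{h'. h' \<le> K \<and> (h = Suc h' \<or> h = h' \<or> Suc h = h')}.
       (\<lambda>ps. ps @ [(int (Suc N), h)]) ` bounded_paths_to K N h')" (is "?L = ?R")
proof
  show "?L \<subseteq> ?R"
  proof
    fix xs assume xs: "xs \<in> ?L"
    have len: "length xs = Suc (Suc N)" by (rule length_bounded_paths_to[OF xs])
    define ps where "ps = butlast xs"
    have eq: "xs = ps @ [(int (Suc N), h)]" 
      using xs len by (metis (mono_tags, lifting) append_butlast_last_id bounded_paths_to_def
          length_0_conv mem_Collect_eq nat.distinct(1) ps_def)
    have ne: "ps \<noteq> []" using len eq by auto
    have step: "motzkin_path ps" "motzkin_step (last ps) (int (Suc N), h)"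
      using xs motzkin_path_snoc[OF ne, of "(int (Suc N), h)"] unfolding bounded_paths_to_def
      by (simp_all add: eq)
    have mem: "last ps \<in> set ps" using ne by simp
    have "ps \<in> bounded_paths_to K N (snd (last ps))"
      using xs step ne unfolding bounded_paths_to_def
      by (auto simp: eq motzkin_step_def prod_eq_iff)
    moreover have "snd (last ps) \<le> K" using xs mem by (simp add: bounded_paths_to_def eq)
    ultimately show "xs \<in> ?R" using step(2) eq by (auto simp: motzkin_step_def)
  qed
  show "?R \<subseteq> ?L"
  proof
    fix xs assume "xs \<in> ?R"
    then obtain ps h' where *: "ps \<in> bounded_paths_to K N h'" "xs = ps @ [(int (Suc N), h)]"
      "h = Suc h' \<or> h = h' \<or> Suc h = h'" by auto
    then have "ps \<noteq> []" by (auto simp: bounded_paths_to_def motzkin_path_def)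
    then show "xs \<in> ?L" using * assms
      by (auto simp: bounded_paths_to_def motzkin_path_snoc motzkin_step_def)
  qed
qed

text \<open>Transfer matrix argument: entry (h', h) of the tridiagonal matrix is the weight of a
  step from h' to h, so appending a step is multiplication by this matrix on the right.\<close>

lemma sum_bounded_paths_to:
  "h \<le> K \<Longrightarrow> (\<Sum>ps\<in>bounded_paths_to K N h. path_weight b l ps) = (tridiag b l K ^\<^sub>m N) $$ (0, h)"
proof (induction N arbitrary: h)
  case 0
  have sub: "ps = [(0, 0)] \<and> h = 0" if ps: "ps \<in> bounded_paths_to K 0 h" for ps
  proof -
    obtain p where "ps = [p]"
      using length_bounded_paths_to[OF ps] by (metis length_0_conv length_Suc_conv)
    then show ?thesis using ps by (auto simp: bounded_paths_to_def)
  qed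
  have mem: "[(0, 0)] \<in> bounded_paths_to K 0 0"
    by (simp add: bounded_paths_to_def motzkin_path_def)
  have "bounded_paths_to K 0 h = (if h = 0 then {[(0, 0)]} else {})"
  proof (cases "h = 0")
    case True
    then have "bounded_paths_to K 0 h \<subseteq> {[(0, 0)]}" using sub by blast
    then show ?thesis using mem True by auto
  next
    case False
    then show ?thesis using sub by auto
  qed
  then show ?case using 0 by (simp add: path_weight_def tridiag_def)
next
  case (Suc N)
  let ?A = "tridiag b l K"
  let ?H = "{h'. h' \<le> K \<and> (h = Suc h' \<or> h = h' \<or> Suc h = h')}"
  let ?f = "\<lambda>ps. ps @ [(int (Suc N), h)]"
  have "(\<Sum>ps\<in>bounded_paths_to K (Suc N) h. path_weight b l ps) =
    (\<Sum>h'\<in>?H. \<Sum>ps\<in>?f ` bounded_paths_to K N h'. path_weight b l ps)"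
    unfolding bounded_paths_to_Suc[OF Suc.prems]
    by (rule sum.UNION_disjoint) (auto simp: finite_bounded_paths_to, auto simp: bounded_paths_to_def)
  also have "\<dots> = (\<Sum>h'\<in>?H. (?A ^\<^sub>m N) $$ (0, h') * ?A $$ (h', h))"
  proof (rule sum.cong[OF refl])
    fix h' assume h': "h' \<in> ?H"
    have "(\<Sum>ps\<in>?f ` bounded_paths_to K N h'. path_weight b l ps) =
      (\<Sum>ps\<in>bounded_paths_to K N h'. path_weight b l ps * ?A $$ (h', h))"
    proof (subst sum.reindex)
      show "inj_on ?f (bounded_paths_to K N h')" by (auto simp: inj_on_def)
      show "sum (path_weight b l \<circ> ?f) (bounded_paths_to K N h') =
        (\<Sum>ps\<in>bounded_paths_to K N h'. path_weight b l ps * ?A $$ (h', h))"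
      proof (rule sum.cong[OF refl])
        fix ps assume "ps \<in> bounded_paths_to K N h'"
        then have "ps \<noteq> []" "last ps = (int N, h')"
          by (auto simp: bounded_paths_to_def motzkin_path_def)
        then show "(path_weight b l \<circ> ?f) ps = path_weight b l ps * ?A $$ (h', h)"
          using h' Suc.prems by (auto simp: path_weight_snoc step_weight_def tridiag_index)
      qed
    qed
    also have "\<dots> = (?A ^\<^sub>m N) $$ (0, h') * ?A $$ (h', h)"
      using Suc.IH[of h'] h' by (simp add: sum_distrib_right[symmetric])
    finally show "(\<Sum>ps\<in>?f ` bounded_paths_to K N h'. path_weight b l ps) =
      (?A ^\<^sub>m N) $$ (0, h') * ?A $$ (h', h)" .
  qed
  \<comment> \<open>Heights from which no step leads to \<open>h\<close> have matrix entry 0, so the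
    sum may run over all heights.\<close>
  also have "\<dots> = (\<Sum>h'<Suc K. (?A ^\<^sub>m N) $$ (0, h') * ?A $$ (h', h))"
    using Suc.prems by (intro sum.mono_neutral_left) (auto simp: tridiag_index)
  also have "\<dots> = (?A ^\<^sub>m Suc N) $$ (0, h)"
    using Suc.prems by (simp only: pow_mat.simps)
       (rule index_mult_mat_sum[of _ "Suc K" "Suc K" _ "Suc K", symmetric], simp_all)
  finally show ?case .
qed

lemma moment_eq: "moment b l K N = (tridiag b l K ^\<^sub>m N) $$ (0, 0)"
  using sum_bounded_paths_to[of 0 K b l N] by (simp add: moment_def bounded_paths_def bounded_paths_to_def)

subsection \<open>Minors\<close>

text \<open>The reversal is conjugation by the permutation matrix \<open>J\<close> of i -> m - 1 -
  i, and \<open>J * J\<close> is the identity.\<close>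

lemma det_rev_rows_cols:
  fixes f :: "nat \<Rightarrow> nat \<Rightarrow> 'a::comm_ring_1"
  shows "det (mat m m (\<lambda>(i, j). f (m - Suc i) (m - Suc j))) = det (mat m m (\<lambda>(i, j). f i j))"
proof -
  define J :: "'a mat" where "J = mat m m (\<lambda>(i, j). if j = m - Suc i then 1 else 0)"
  define M where "M = mat m m (\<lambda>(i, j). f i j)"
  have J: "J \<in> carrier_mat m m" and M: "M \<in> carrier_mat m m" by (simp_all add: J_def M_def)
  have JX: "(J * X) $$ (i, j) = X $$ (m - Suc i, j)"
    if "X \<in> carrier_mat m m" "i < m" "j < m" for X i j
  proof -
    have "(J * X) $$ (i, j) = (\<Sum>a<m. if a = m - Suc i then X $$ (a, j) else 0)"
      unfolding index_mult_mat_sum[OF J that]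
      using that by (intro sum.cong) (auto simp: J_def)
    also have "\<dots> = X $$ (m - Suc i, j)" using that by simp
    finally show ?thesis .
  qed
  have XJ: "(X * J) $$ (i, j) = X $$ (i, m - Suc j)"
    if "X \<in> carrier_mat m m" "i < m" "j < m" for X i j
  proof -
    have "(X * J) $$ (i, j) = (\<Sum>a<m. if a = m - Suc j then X $$ (i, a) else 0)"
      unfolding index_mult_mat_sum[OF that(1) J that(2,3)]
      using that by (intro sum.cong) (auto simp: J_def)
    also have "\<dots> = X $$ (i, m - Suc j)" using that by simp
    finally show ?thesis .
  qed
  have JJ: "J * J = 1\<^sub>m m"
    by (rule eq_matI) (use J in \<open>auto simp: JX[OF J] simp del: index_mult_mat(1), auto simp: J_def\<close>)
  have "mat m m (\<lambda>(i, j). f (m - Suc i) (m - Suc j)) = J * M * J"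
  proof (rule eq_matI)
    fix i j assume "i < dim_row (J * M * J)" "j < dim_col (J * M * J)"
    then have ij: "i < m" "j < m" using J M by auto
    have "(J * M * J) $$ (i, j) = M $$ (m - Suc i, m - Suc j)"
      using ij J M by (simp add: XJ JX del: index_mult_mat(1))
    then show "mat m m (\<lambda>(i, j). f (m - Suc i) (m - Suc j)) $$ (i, j) = (J * M * J) $$ (i, j)"
      using ij by (simp add: M_def)
  qed (use J M in auto)
  also have "det (J * M * J) = det (J * J) * det M"
    using J M by (simp add: det_mult[of _ m] mult.commute mult.left_commute)
  also have "\<dots> = det M" by (simp add: JJ)
  finally show ?thesis by (simp add: M_def)
qed

lemma det_swap_rows_cols:
  fixes f :: "nat \<Rightarrow> nat \<Rightarrow> 'a::comm_ring_1"
  shows "det (mat m m (\<lambda>(i, j). f j i)) = det (mat m m (\<lambda>(i, j). f i j))"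
proof -
  have "mat m m (\<lambda>(i, j). f j i) = transpose_mat (mat m m (\<lambda>(i, j). f i j))"
    by (rule eq_matI) auto
  then show ?thesis by (simp add: det_transpose[of _ m])
qed

text \<open>\<open>E\<close> is the identity with its last \<open>m\<close> columns replaced by
  those of \<open>D\<close>. Then \<open>C * E\<close> keeps the first \<open>k\<close> columns of
  \<open>C\<close> and has identity columns after them. Both \<open>E\<close> and the product
  \<open>F\<close> are block triangular, so their determinants are the two minors.\<close>

lemma jacobi_complementary_minor:
  fixes C D :: "'a::idom mat"
  assumes C: "C \<in> carrier_mat (k + m) (k + m)" and D: "D \<in> carrier_mat (k + m) (k + m)"
    and CD: "C * D = 1\<^sub>m (k + m)"
  shows "det (mat k k (\<lambda>(i, j). C $$ (i, j))) =
    det C * det (mat m m (\<lambda>(i, j). D $$ (k + i, k + j)))"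
proof -
  define D22 where "D22 = mat m m (\<lambda>(i, j). D $$ (k + i, k + j))"
  define E where "E = four_block_mat (1\<^sub>m k) (mat k m (\<lambda>(i, j). D $$ (i, k + j))) (0\<^sub>m m k) D22"
  define C11 where "C11 = mat k k (\<lambda>(i, j). C $$ (i, j))"
  define F where "F = four_block_mat C11 (0\<^sub>m k m) (mat m k (\<lambda>(i, j). C $$ (k + i, j))) (1\<^sub>m m)"
  have E: "E \<in> carrier_mat (k + m) (k + m)" 
    unfolding E_def D22_def by (rule four_block_carrier_mat) simp_all
  have F: "F \<in> carrier_mat (k + m) (k + m)" 
    unfolding F_def C11_def by (rule four_block_carrier_mat) simp_all
  have "C * E = F"
  proof (rule eq_matI)
    fix i j assume "i < dim_row F" "j < dim_col F"
    then have ij: "i < k + m" "j < k + m" using F by auto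
    have CE: "(C * E) $$ (i, j) = (\<Sum>a<k + m. C $$ (i, a) * E $$ (a, j))"
      by (rule index_mult_mat_sum[OF C E ij])
    show "(C * E) $$ (i, j) = F $$ (i, j)"
    proof (cases "j < k")
      case True
      have "(C * E) $$ (i, j) = (\<Sum>a<k + m. if a = j then C $$ (i, a) else 0)"
        unfolding CE using True ij by (intro sum.cong) (auto simp: E_def D22_def)
      also have "\<dots> = F $$ (i, j)" using True ij by (auto simp: F_def C11_def)
      finally show ?thesis .
    next
      case False
      have "(C * E) $$ (i, j) = (\<Sum>a<k + m. C $$ (i, a) * D $$ (a, j))"
        unfolding CE using False ij by (intro sum.cong) (auto simp: E_def D22_def)
      also have "\<dots> = (C * D) $$ (i, j)" by (rule index_mult_mat_sum[OF C D ij, symmetric])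
      also have "\<dots> = F $$ (i, j)" unfolding CD using False ij by (auto simp: F_def C11_def)
      finally show ?thesis .
    qed
  qed (use C E F in auto)
  moreover have "det F = det C11"
    unfolding F_def by (subst det_four_block_mat_upper_right_zero[of _ k _ m]) (auto simp: C11_def)
  moreover have "det E = det D22"
    unfolding E_def by (subst det_four_block_mat_lower_left_zero[of _ k _ m]) (auto simp: D22_def)
  ultimately show ?thesis using det_mult[OF C E] by (simp add: C11_def D22_def)
qed

text \<open>The matrix factors as \<open>U * M * V\<close>: \<open>M\<close> is the leading block of
  \<open>C\<close>, the rows of \<open>U\<close> are first rows of powers of \<open>A\<close> (lower
  unitriangular), and the columns of \<open>V\<close> are first columns of powers (upper triangular
  with diagonal lambda_1 ... lambda_j).\<close>

lemma det_corner_eq_leading_minor: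
  fixes b l :: "nat \<Rightarrow> 'a::idom" and K :: nat
  assumes C: "C \<in> carrier_mat (Suc K) (Suc K)" and k: "k \<le> Suc K"
  defines "A \<equiv> tridiag b l K"
  shows "det (mat k k (\<lambda>(i, j). (A ^\<^sub>m i * C * A ^\<^sub>m j) $$ (0, 0))) =
    (\<Prod>i=1..<k. l i ^ (k - i)) * det (mat k k (\<lambda>(i, j). C $$ (i, j)))"
proof -
  define U where "U = mat k k (\<lambda>(i, a). (A ^\<^sub>m i) $$ (0, a))"
  define V where "V = mat k k (\<lambda>(a, j). (A ^\<^sub>m j) $$ (a, 0))"
  define M where "M = mat k k (\<lambda>(i, j). C $$ (i, j))"
  have U: "U \<in> carrier_mat k k" and V: "V \<in> carrier_mat k k" and M: "M \<in> carrier_mat k k"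
    by (simp_all add: U_def V_def M_def)
  have A: "A \<in> carrier_mat (Suc K) (Suc K)" by (simp add: A_def)
  have row: "(A ^\<^sub>m t) $$ (0, j) = (if j = t then 1 else 0)" if "j \<le> K" "t \<le> j" for j t
    unfolding A_def by (rule tridiag_pow_row[OF that])
  have col: "(A ^\<^sub>m t) $$ (j, 0) = (if j = t then \<Prod>i=1..t. l i else 0)" if "j \<le> K" "t \<le> j" for j t
    unfolding A_def by (rule tridiag_pow_col[OF that])
  have detU: "det U = 1"
    by (subst det_lower_triangular[OF _ U])
       (use k in \<open>auto simp: prod_list_diag_prod U_def row intro!: prod.neutral\<close>)
  have "det V = (\<Prod>j<k. \<Prod>i=1..j. l i)"
    by (subst det_upper_triangular[OF _ V])
       (use k in \<open>auto simp: prod_list_diag_prod V_def col atLeast0LessThan upper_triangular_def\<close>)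
  \<comment> \<open>\<open>l i\<close> divides the diagonal entries with index j = i, ..., k - 1,
    which are k - i in number.\<close>
  also have "\<dots> = (\<Prod>i=1..<k. l i ^ (k - i))"
  proof (induction k)
    case 0
    then show ?case by simp
  next
    case (Suc k)
    have "(\<Prod>i=1..<Suc k. l i ^ (Suc k - i)) = (\<Prod>i=1..<Suc k. l i ^ (k - i) * l i)"
      by (intro prod.cong) (auto simp: Suc_diff_le)
    also have "\<dots> = (\<Prod>i=1..<Suc k. l i ^ (k - i)) * (\<Prod>i=1..k. l i)"
      by (simp add: prod.distrib atLeastLessThanSuc_atLeastAtMost)
    also have "(\<Prod>i=1..<Suc k. l i ^ (k - i)) = (\<Prod>i=1..<k. l i ^ (k - i))"
      by (cases "k = 0") (simp_all add: prod.atLeastLessThan_Suc)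
    finally show ?case using Suc by simp
  qed
  finally have detV: "det V = (\<Prod>i=1..<k. l i ^ (k - i))" .
  have "mat k k (\<lambda>(i, j). (A ^\<^sub>m i * C * A ^\<^sub>m j) $$ (0, 0)) = U * M * V"
  proof (rule eq_matI)
    fix i j assume "i < dim_row (U * M * V)" "j < dim_col (U * M * V)"
    then have ij: "i < k" "j < k" using U V by auto
    have Ai: "A ^\<^sub>m i \<in> carrier_mat (Suc K) (Suc K)" "A ^\<^sub>m j \<in> carrier_mat (Suc K) (Suc K)"
      using A by simp_all
    have inner: "(A ^\<^sub>m i * C) $$ (0, c) = (U * M) $$ (i, c)" if c: "c < k" for c
    proof -
      have "(A ^\<^sub>m i * C) $$ (0, c) = (\<Sum>a<Suc K. (A ^\<^sub>m i) $$ (0, a) * C $$ (a, c))"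
        using c k by (intro index_mult_mat_sum[OF Ai(1) C]) auto
      \<comment> \<open>Since i < k, the first row of A^i vanishes from position k on.\<close>
      also have "\<dots> = (\<Sum>a<k. (A ^\<^sub>m i) $$ (0, a) * C $$ (a, c))"
        using k ij by (intro sum.mono_neutral_right) (auto simp: row)
      also have "\<dots> = (U * M) $$ (i, c)"
        unfolding index_mult_mat_sum[OF U M ij(1) c] using ij c
        by (intro sum.cong) (auto simp: U_def M_def)
      finally show ?thesis .
    qed
    have "(A ^\<^sub>m i * C * A ^\<^sub>m j) $$ (0, 0) =
        (\<Sum>c<Suc K. (A ^\<^sub>m i * C) $$ (0, c) * (A ^\<^sub>m j) $$ (c, 0))"
      using Ai C by (intro index_mult_mat_sum[of _ "Suc K" "Suc K" _ "Suc K"]) auto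
    also have "\<dots> = (\<Sum>c<k. (A ^\<^sub>m i * C) $$ (0, c) * (A ^\<^sub>m j) $$ (c, 0))"
      using k ij by (intro sum.mono_neutral_right) (auto simp: col)
    also have "\<dots> = (\<Sum>c<k. (U * M) $$ (i, c) * V $$ (c, j))"
      using ij by (intro sum.cong) (auto simp: inner V_def simp del: index_mult_mat(1))
    also have "\<dots> = (U * M * V) $$ (i, j)"
      using U M V ij by (intro index_mult_mat_sum[of _ k k _ k, symmetric]) auto
    finally show "mat k k (\<lambda>(i, j). (A ^\<^sub>m i * C * A ^\<^sub>m j) $$ (0, 0)) $$ (i, j) =
        (U * M * V) $$ (i, j)"
      using ij by simp
  qed (use U V in auto)
  also have "det (U * M * V) = det V * det M"
    using U V M by (simp add: det_mult[of _ k] detU mult.commute)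
  finally show ?thesis by (simp add: detV M_def)
qed

subsection \<open>Moments with negative index\<close>

text \<open>The first rows of A^0, ..., A^(t-1) are unitriangular, so they span all vectors
  supported on the first t positions. The last coefficient is the entry of \<open>v\<close> at the
  top position, and subtracting that multiple clears the position.\<close>

lemma first_rows_span:
  fixes b l :: "nat \<Rightarrow> 'a::comm_ring_1"
  assumes "t \<le> Suc K" "\<And>j. t \<le> j \<Longrightarrow> j \<le> K \<Longrightarrow> v j = 0"
  shows "\<exists>a. \<forall>j\<le>K. v j = (\<Sum>i<t. a i * (tridiag b l K ^\<^sub>m i) $$ (0, j))"
  using assms
proof (induction t arbitrary: v)
  case 0
  then show ?case by simp
next
  case (Suc t)
  let ?r = "\<lambda>i j. (tridiag b l K ^\<^sub>m i) $$ (0, j)"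
  have "\<exists>a. \<forall>j\<le>K. v j - v t * ?r t j = (\<Sum>i<t. a i * ?r i j)"
  proof (rule Suc.IH)
    show "v j - v t * ?r t j = 0" if "t \<le> j" "j \<le> K" for j
      using that Suc.prems(2)[of j] by (auto simp: tridiag_pow_row)
  qed (use Suc.prems in simp)
  then obtain a where a: "v j - v t * ?r t j = (\<Sum>i<t. a i * ?r i j)" if "j \<le> K" for j by blast
  have "v j = (\<Sum>i<Suc t. (a(t := v t)) i * ?r i j)" if "j \<le> K" for j
    using a[OF that] by (simp add: algebra_simps)
  then show ?case by blast
qed

text \<open>Expanding the first row of A^(K+1) in those of A^0, ..., A^K and multiplying by A^N
  gives a recurrence of order K + 1, valid for every integer N.\<close>

lemma is_extension_moment:
  fixes b l :: "nat \<Rightarrow> 'a::field" and K :: nat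
  defines "A \<equiv> tridiag b l K"
  assumes B: "B \<in> carrier_mat (Suc K) (Suc K)"
    and AB: "A * B = 1\<^sub>m (Suc K)" and BA: "B * A = 1\<^sub>m (Suc K)"
  shows "is_extension (moment b l K) (\<lambda>N. zpow_mat A B N $$ (0, 0))"
proof -
  have A: "A \<in> carrier_mat (Suc K) (Suc K)" by (simp add: A_def)
  note Z = zpow_mat_carrier[OF A B AB BA]
  obtain a where "\<And>j. j \<le> K \<Longrightarrow>
      (A ^\<^sub>m Suc K) $$ (0, j) = (\<Sum>i<Suc K. a i * (A ^\<^sub>m i) $$ (0, j))"
    using first_rows_span[of "Suc K" K "\<lambda>j. (A ^\<^sub>m Suc K) $$ (0, j)" b l] unfolding A_def by auto
  note a = this
  have shift: "(\<Sum>j<Suc K. (A ^\<^sub>m i) $$ (0, j) * zpow_mat A B N $$ (j, c)) =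
      zpow_mat A B (N + int i) $$ (0, c)" if "c \<le> K" for i N c
    unfolding zpow_mat_add_left[OF A B AB BA] using A Z that
    by (intro index_mult_mat_sum[of _ "Suc K" "Suc K" _ "Suc K", symmetric]) auto
  \<comment> \<open>All columns are kept: column 0 carries the moments, and column \<open>K\<close>
    shows that the last coefficient is nonzero.\<close>
  have rec: "zpow_mat A B (N + int (Suc K)) $$ (0, c) =
      (\<Sum>i<Suc K. a i * zpow_mat A B (N + int i) $$ (0, c))" if c: "c \<le> K" for N c
  proof -
    have "zpow_mat A B (N + int (Suc K)) $$ (0, c) =
        (\<Sum>j<Suc K. (\<Sum>i<Suc K. a i * (A ^\<^sub>m i) $$ (0, j)) * zpow_mat A B N $$ (j, c))"
      unfolding shift[OF c, symmetric] by (intro sum.cong) (simp_all add: a del: pow_mat.simps)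
    also have "\<dots> =
        (\<Sum>i<Suc K. \<Sum>j<Suc K. a i * ((A ^\<^sub>m i) $$ (0, j) * zpow_mat A B N $$ (j, c)))"
      unfolding sum_distrib_right mult.assoc by (rule sum.swap)
    also have "\<dots> = (\<Sum>i<Suc K. a i * zpow_mat A B (N + int i) $$ (0, c))"
      unfolding sum_distrib_left[symmetric] shift[OF c] ..
    finally show ?thesis .
  qed
  \<comment> \<open>Otherwise the recurrence at N = -1 writes the first row of A^K through those of
    A^0, ..., A^(K-1). These vanish at position \<open>K\<close>, where A^K has a 1.\<close>
  have "a 0 \<noteq> 0"
  proof
    assume "a 0 = 0"
    then have "zpow_mat A B (- 1 + int (Suc K)) $$ (0, K) =
        (\<Sum>i<K. a (Suc i) * zpow_mat A B (int i) $$ (0, K))"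
      unfolding rec[OF order_refl] sum.lessThan_Suc_shift by simp
    also have "\<dots> = 0"
      unfolding zpow_mat_of_nat by (intro sum.neutral) (auto simp: A_def tridiag_pow_row)
    also have "zpow_mat A B (- 1 + int (Suc K)) = A ^\<^sub>m K"
      using zpow_mat_of_nat[of A B K] by simp
    finally show False by (simp add: A_def tridiag_pow_row)
  qed
  moreover have "linear_recurrence (Suc K) (\<lambda>i. a (Suc K - i)) (\<lambda>N. zpow_mat A B N $$ (0, 0))"
    unfolding linear_recurrence_def
  proof
    fix N
    have "zpow_mat A B N $$ (0, 0) =
        (\<Sum>i<Suc K. a i * zpow_mat A B (N - int (Suc K) + int i) $$ (0, 0))"
      using rec[of 0 "N - int (Suc K)"] by simp
    also have "\<dots> = (\<Sum>i=1..Suc K. a (Suc K - i) * zpow_mat A B (N - int i) $$ (0, 0))"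
      by (rule sum.reindex_bij_witness[of _ "\<lambda>i. Suc K - i" "\<lambda>i. Suc K - i"])
         (auto simp: of_nat_diff algebra_simps)
    finally show "zpow_mat A B N $$ (0, 0) =
      (\<Sum>i=1..Suc K. a (Suc K - i) * zpow_mat A B (N - int i) $$ (0, 0))" .
  qed
  ultimately show ?thesis
    unfolding is_extension_def
    by (intro conjI exI[of _ "Suc K"] exI[of _ "\<lambda>i. a (Suc K - i)"]) (auto simp: moment_eq A_def)
qed

subsection \<open>The identity over a field with a reversing endomorphism\<close>

text \<open>\<open>flp\<close> reflects in the antidiagonal and applies \<open>R\<close>. Like
  transposition it reverses products; the extra reversal of indices only substitutes K - a for the
  summation index.\<close>

lemma mult_rev_entries:
  fixes X Y :: "'a::comm_ring_1 mat" and K :: nat and R :: "'a \<Rightarrow> 'a"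
  assumes "comm_ring_hom R"
    and X: "X \<in> carrier_mat (Suc K) (Suc K)" and Y: "Y \<in> carrier_mat (Suc K) (Suc K)"
  defines "flp \<equiv> (\<lambda>X. mat (Suc K) (Suc K) (\<lambda>(i, j). R (X $$ (K - j, K - i))))"
  shows "flp (X * Y) = flp Y * flp X"
proof (rule eq_matI)
  interpret comm_ring_hom R by fact
  fix i j assume "i < dim_row (flp Y * flp X)" "j < dim_col (flp Y * flp X)"
  then have ij: "i < Suc K" "j < Suc K" by (auto simp: flp_def)
  have "flp (X * Y) $$ (i, j) = R (\<Sum>a<Suc K. X $$ (K - j, a) * Y $$ (a, K - i))"
    using ij index_mult_mat_sum[OF X Y, of "K - j" "K - i"] by (simp add: flp_def)
  also have "\<dots> = (\<Sum>a<Suc K. R (Y $$ (a, K - i)) * R (X $$ (K - j, a)))"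
    by (simp only: hom_sum hom_mult mult.commute)
  also have "\<dots> = (\<Sum>a<Suc K. R (Y $$ (K - a, K - i)) * R (X $$ (K - j, K - a)))"
    using sum.nat_diff_reindex[of "\<lambda>a. R (Y $$ (a, K - i)) * R (X $$ (K - j, a))" "Suc K"]
    by simp
  also have "\<dots> = (\<Sum>a<Suc K. flp Y $$ (i, a) * flp X $$ (a, j))"
    using ij by (intro sum.cong) (simp_all add: flp_def)
  also have "\<dots> = (flp Y * flp X) $$ (i, j)"
    using ij by (intro index_mult_mat_sum[of _ "Suc K" "Suc K" _ "Suc K", symmetric])
      (auto simp: flp_def)
  finally show "flp (X * Y) $$ (i, j) = (flp Y * flp X) $$ (i, j)" .
qed (auto simp: flp_def)

text \<open>Reversing both index ranges, transposing and applying \<open>R\<close> is an anti-homomorphism of the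
  matrix ring. It fixes the tridiagonal matrix, hence also the powers of its inverse.\<close>

lemma rev_entries_inverse_pow:
  fixes b l :: "nat \<Rightarrow> 'a::comm_ring_1" and K :: nat
  assumes R: "comm_ring_hom R"
    and Rb: "\<And>i. i \<le> K \<Longrightarrow> R (b i) = b (K - i)"
    and Rl: "\<And>i. 1 \<le> i \<Longrightarrow> i \<le> K \<Longrightarrow> R (l i) = l (K + 1 - i)"
  defines "A \<equiv> tridiag b l K"
  assumes B: "B \<in> carrier_mat (Suc K) (Suc K)"
    and AB: "A * B = 1\<^sub>m (Suc K)" and BA: "B * A = 1\<^sub>m (Suc K)"
    and ij: "i \<le> K" "j \<le> K"
  shows "(B ^\<^sub>m t) $$ (i, j) = R ((B ^\<^sub>m t) $$ (K - j, K - i))"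
proof -
  interpret comm_ring_hom R by fact
  define flp :: "'a mat \<Rightarrow> 'a mat"
    where "flp = (\<lambda>X. mat (Suc K) (Suc K) (\<lambda>(i, j). R (X $$ (K - j, K - i))))"
  have A: "A \<in> carrier_mat (Suc K) (Suc K)" by (simp add: A_def)
  have flp: "flp X \<in> carrier_mat (Suc K) (Suc K)" for X by (simp add: flp_def)
  have mult: "flp (X * Y) = flp Y * flp X"
    if "X \<in> carrier_mat (Suc K) (Suc K)" "Y \<in> carrier_mat (Suc K) (Suc K)" for X Y
    unfolding flp_def by (rule mult_rev_entries[OF R that])
  have one: "flp (1\<^sub>m (Suc K)) = 1\<^sub>m (Suc K)"
    by (rule eq_matI) (auto simp: flp_def)
  \<comment> \<open>The reflection maps each of the three diagonals to itself in reverse order, and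
    \<open>R\<close> undoes the reversal of the b's and of the lambdas.\<close>
  have flpA: "flp A = A"
  proof (rule eq_matI)
    fix i j assume "i < dim_row A" "j < dim_col A"
    then have ij: "i \<le> K" "j \<le> K" using A by auto
    have flpA: "flp A $$ (i, j) = R (A $$ (K - j, K - i))" using ij by (simp add: flp_def)
    consider "j = i" | "j = Suc i" | "i = Suc j" | "j \<noteq> i" "j \<noteq> Suc i" "i \<noteq> Suc j" by blast
    then show "flp A $$ (i, j) = A $$ (i, j)"
    proof cases
      case 1
      then show ?thesis unfolding flpA using ij by (simp add: A_def tridiag_index Rb)
    next
      case 2
      then have "K - i = Suc (K - j)" using ij by simp
      then show ?thesis unfolding flpA using ij 2 by (simp add: A_def tridiag_index)
    next
      case 3
      then have "K - j = Suc (K - i)" "R (l (K - j)) = l i" using ij Rl[of "K - j"] by simp_all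
      then show ?thesis unfolding flpA using ij 3 by (simp add: A_def tridiag_index)
    next
      case 4
      then have "K - i \<noteq> K - j" "K - i \<noteq> Suc (K - j)" "K - j \<noteq> Suc (K - i)" using ij by linarith+
      then show ?thesis unfolding flpA using ij 4 by (simp add: A_def tridiag_index)
    qed
  qed (use A flp in auto)
  \<comment> \<open>\<open>flp B\<close> is again an inverse of \<open>A\<close>, hence equal to
    \<open>B\<close>.\<close>
  have "A * flp B = 1\<^sub>m (Suc K)"
    using mult[OF B A] by (simp only: BA one flpA)
  then have "B * A * flp B = B"
    unfolding assoc_mult_mat[OF B A flp] by (simp only: right_mult_one_mat[OF B])
  then have flpB: "flp B = B" by (simp only: BA left_mult_one_mat[OF flp])
  have "flp (B ^\<^sub>m t) = B ^\<^sub>m t"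
  proof (induction t)
    case 0
    have "B ^\<^sub>m 0 = 1\<^sub>m (Suc K)" using B by simp
    then show ?case by (simp only: one)
  next
    case (Suc t)
    have "flp (B ^\<^sub>m Suc t) = flp B * flp (B ^\<^sub>m t)"
      using mult[OF pow_carrier_mat[OF B] B] by simp
    then show ?case unfolding Suc flpB pow_mat_Suc_left[OF B] .
  qed
  then have "(B ^\<^sub>m t) $$ (i, j) = flp (B ^\<^sub>m t) $$ (i, j)" by simp
  then show ?thesis using ij by (simp add: flp_def)
qed

text \<open>Carries out the whole argument for any ring endomorphism \<open>R\<close> that reverses
  the parameters. The lambdas must be nonzero because the exponent k - i is negative for i >
  k.\<close>

lemma hankel_det_reciprocity:
  fixes b l :: "nat \<Rightarrow> 'a::field" and k m n :: nat
  assumes k: "k > 0" and m: "m > 0"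
  defines "K \<equiv> k + m - 1"
  assumes R: "comm_ring_hom R"
    and Rb: "\<And>i. i \<le> K \<Longrightarrow> R (b i) = b (K - i)"
    and Rl: "\<And>i. 1 \<le> i \<Longrightarrow> i \<le> K \<Longrightarrow> R (l i) = l (K + 1 - i)"
    and l0: "\<And>i. 1 \<le> i \<Longrightarrow> i \<le> K \<Longrightarrow> l i \<noteq> 0"
    and det0: "det (tridiag b l K) \<noteq> 0"
  shows "det (mat k k (\<lambda>(i, j). moment b l K (n + i + j + 2 * m - 2))) =
    (\<Prod>i = 1..K. l i powi (int k - int i)) * det (tridiag b l K) ^ (n + 2 * m - 2) *
    R (det (mat m m (\<lambda>(i, j). moment_int b l K (- int n - int i - int j))))"
proof -
  interpret comm_ring_hom R by fact
  define A where "A = tridiag b l K"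
  \<comment> \<open>The smallest index on the left is N, and the smallest on the right is -N,
    attained at i = j = m - 1.\<close>
  define N where "N = n + 2 * m - 2"
  have sK: "Suc K = k + m" using k by (simp add: K_def)
  have A: "A \<in> carrier_mat (Suc K) (Suc K)" by (simp add: A_def)
  obtain B where B: "B \<in> carrier_mat (Suc K) (Suc K)"
    and AB: "A * B = 1\<^sub>m (Suc K)" and BA: "B * A = 1\<^sub>m (Suc K)"
    using ex_inverse_mat[OF A] det0 unfolding A_def by blast
  define Q where "Q = (\<Prod>i=1..<m. l i ^ (m - i))"
  define D where "D = det (mat m m (\<lambda>(i, j). (B ^\<^sub>m N) $$ (i, j)))"

  have "det (mat k k (\<lambda>(i, j). moment b l K (n + i + j + 2 * m - 2))) =
      det (mat k k (\<lambda>(i, j). (A ^\<^sub>m i * A ^\<^sub>m N * A ^\<^sub>m j) $$ (0, 0)))"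
  proof -
    have "moment b l K (n + i + j + 2 * m - 2) = (A ^\<^sub>m i * A ^\<^sub>m N * A ^\<^sub>m j) $$ (0, 0)" for i j
    proof -
      have "n + i + j + 2 * m - 2 = N + i + j" using m by (simp add: N_def)
      then show ?thesis
        using zpow_mat_add_both[OF A B AB BA, of "int N" i j] zpow_mat_of_nat[of A B "N + i + j"]
        by (simp add: moment_eq A_def)
    qed
    then show ?thesis by simp
  qed
  also have "\<dots> = (\<Prod>i=1..<k. l i ^ (k - i)) * det (mat k k (\<lambda>(i, j). (A ^\<^sub>m N) $$ (i, j)))"
    unfolding A_def by (rule det_corner_eq_leading_minor[OF pow_carrier_mat[OF tridiag_carrier]]) (simp add: K_def)
  also have "det (mat k k (\<lambda>(i, j). (A ^\<^sub>m N) $$ (i, j))) =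
      det A ^ N * det (mat m m (\<lambda>(i, j). (B ^\<^sub>m N) $$ (k + i, k + j)))"
    using jacobi_complementary_minor[of "A ^\<^sub>m N" k m "B ^\<^sub>m N", folded sK]
      pow_carrier_mat[OF A, of N] pow_carrier_mat[OF B, of N]
      pow_mat_inverse[OF A B AB, of N] det_pow_mat[OF A, of N] by simp
  \<comment> \<open>The reflection carries the trailing block to the leading one, since K - (k + i)
    = m - 1 - i.\<close>
  also have "det (mat m m (\<lambda>(i, j). (B ^\<^sub>m N) $$ (k + i, k + j))) =
      det (mat m m (\<lambda>(i, j). R ((B ^\<^sub>m N) $$ (m - Suc j, m - Suc i))))"
  proof (intro arg_cong[of _ _ det] cong_mat refl)
    fix i j assume ij: "i < m" "j < m"
    have "K - (k + j) = m - Suc j" "K - (k + i) = m - Suc i" using ij by (auto simp: K_def)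
    then show "(case (i, j) of (i, j) \<Rightarrow> (B ^\<^sub>m N) $$ (k + i, k + j)) =
        (case (i, j) of (i, j) \<Rightarrow> R ((B ^\<^sub>m N) $$ (m - Suc j, m - Suc i)))"
      using rev_entries_inverse_pow[OF R Rb Rl B AB[unfolded A_def] BA[unfolded A_def],
          of "k + i" "k + j" N] ij sK by simp
  qed
  also have "\<dots> = det (mat m m (\<lambda>(i, j). R ((B ^\<^sub>m N) $$ (i, j))))"
    using det_swap_rows_cols[of m "\<lambda>i j. R ((B ^\<^sub>m N) $$ (m - Suc i, m - Suc j))"]
      det_rev_rows_cols[of m "\<lambda>i j. R ((B ^\<^sub>m N) $$ (i, j))"] by simp
  also have "\<dots> = R D"
  proof -
    have "mat m m (\<lambda>(i, j). R ((B ^\<^sub>m N) $$ (i, j))) =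
        map_mat R (mat m m (\<lambda>(i, j). (B ^\<^sub>m N) $$ (i, j)))"
      by (rule eq_matI) auto
    then show ?thesis by (simp add: D_def)
  qed
  finally have lhs: "det (mat k k (\<lambda>(i, j). moment b l K (n + i + j + 2 * m - 2))) =
      (\<Prod>i=1..<k. l i ^ (k - i)) * (det A ^ N * R D)" .

  have mi: "moment_int b l K M = zpow_mat A B M $$ (0, 0)" for M
    unfolding moment_int_def A_def
    by (subst extension_eqI[OF is_extension_moment[OF B AB[unfolded A_def] BA[unfolded A_def]]]) simp
  \<comment> \<open>Reversing rows and columns turns the indices -n - i - j into -N + i + j, so that
    positive powers of \<open>A\<close> surround B^N.\<close>
  have "det (mat m m (\<lambda>(i, j). moment_int b l K (- int n - int i - int j))) =
      det (mat m m (\<lambda>(i, j). moment_int b l K (- int n - int (m - Suc i) - int (m - Suc j))))"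
    by (rule det_rev_rows_cols[symmetric])
  also have "\<dots> = det (mat m m (\<lambda>(i, j). (A ^\<^sub>m i * B ^\<^sub>m N * A ^\<^sub>m j) $$ (0, 0)))"
  proof (intro arg_cong[of _ _ det] cong_mat refl)
    fix i j assume "i < m" "j < m"
    then have "- int n - int (m - Suc i) - int (m - Suc j) = - int N + int i + int j"
      using m by (simp add: N_def of_nat_diff)
    then show "(case (i, j) of (i, j) \<Rightarrow>
          moment_int b l K (- int n - int (m - Suc i) - int (m - Suc j))) =
        (case (i, j) of (i, j) \<Rightarrow> (A ^\<^sub>m i * B ^\<^sub>m N * A ^\<^sub>m j) $$ (0, 0))"
      using zpow_mat_add_both[OF A B AB BA, of "- int N" i j] zpow_mat_minus_of_nat[OF A B, of N]
      by (simp add: mi)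
  qed
  also have "\<dots> = Q * D"
    unfolding A_def Q_def D_def
    by (rule det_corner_eq_leading_minor[OF pow_carrier_mat[OF B]]) (use k in \<open>simp add: K_def\<close>)
  finally have rhs: "R (det (mat m m (\<lambda>(i, j). moment_int b l K (- int n - int i - int j)))) =
      R Q * R D" by (simp add: hom_mult)

  \<comment> \<open>Comparison of monomials: in the product up to \<open>K\<close>, the factors with
    i <= k form the monomial of the left side, and those with i > k cancel
    \<open>R Q\<close>.\<close>
  have "R Q = (\<Prod>i=1..<m. l (k + m - i) ^ (m - i))"
    unfolding Q_def hom_prod using k sK by (intro prod.cong) (auto simp: hom_power Rl)
  moreover have "(\<Prod>i=1..K. l i powi (int k - int i)) =
      (\<Prod>i=1..k. l i powi (int k - int i)) * (\<Prod>i=Suc k..K. l i powi (int k - int i))"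
    using m prod.ub_add_nat[of 1 k "\<lambda>i. l i powi (int k - int i)" "m - 1"] by (simp add: K_def)
  moreover have "(\<Prod>i=1..k. l i powi (int k - int i)) = (\<Prod>i=1..<k. l i ^ (k - i))"
  proof -
    have "(\<Prod>i=1..k. l i powi (int k - int i)) = (\<Prod>i=1..k. l i ^ (k - i))"
      by (intro prod.cong) (auto simp: power_int_of_nat[symmetric] of_nat_diff simp del: power_int_of_nat)
    then show ?thesis using k by (cases k) (simp_all add: atLeastLessThanSuc_atLeastAtMost)
  qed
  \<comment> \<open>The substitution i -> k + m - i turns the exponent k - i into i - m.\<close>
  moreover have "(\<Prod>i=Suc k..K. l i powi (int k - int i)) =
      (\<Prod>i=1..<m. l (k + m - i) powi (int i - int m))"
    by (rule prod.reindex_bij_witness[of _ "\<lambda>i. k + m - i" "\<lambda>i. k + m - i"])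
       (auto simp: K_def of_nat_diff)
  moreover have "(\<Prod>i=1..<m. l (k + m - i) powi (int i - int m)) *
      (\<Prod>i=1..<m. l (k + m - i) ^ (m - i)) = 1"
    unfolding prod.distrib[symmetric]
  proof (intro prod.neutral ballI)
    fix i assume i: "i \<in> {1..<m}"
    then have "l (k + m - i) \<noteq> 0" by (intro l0) (auto simp: K_def)
    moreover have "l (k + m - i) ^ (m - i) = l (k + m - i) powi (int m - int i)"
      using i by (simp add: of_nat_diff flip: power_int_of_nat)
    ultimately show "l (k + m - i) powi (int i - int m) * l (k + m - i) ^ (m - i) = 1"
      by (simp flip: power_int_add)
  qed
  ultimately have "(\<Prod>i=1..K. l i powi (int k - int i)) * R Q = (\<Prod>i=1..<k. l i ^ (k - i))"
    by (simp add: mult.assoc)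
  then have "(\<Prod>i=1..<k. l i ^ (k - i)) * (det A ^ N * R D) =
      (\<Prod>i=1..K. l i powi (int k - int i)) * det A ^ N * (R Q * R D)"
    by (metis mult.assoc mult.left_commute)
  then show ?thesis unfolding lhs rhs by (simp add: A_def N_def)
qed

subsection \<open>Rational functions\<close>

lemma R_op_comm_ring_hom: "comm_ring_hom (R_op N :: 'a::field ratfun \<Rightarrow> 'a ratfun)"
proof
  show "R_op N (0 :: 'a ratfun) = 0"
    unfolding Zero_fract_def R_op_Fract[OF one_neq_zero] flip_mpoly_0 flip_mpoly_1 by (rule refl)
  show "R_op N (1 :: 'a ratfun) = 1"
    unfolding One_fract_def R_op_Fract[OF one_neq_zero] flip_mpoly_1 by (rule refl)
qed (rule R_op_add R_op_mult)+

text \<open>Evaluation at \<open>0\<close> for the indeterminates with odd index and at \<open>1\<close> for the others,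
  that is, at $b_i = 1$ and $\lambda_i = 0$.\<close>

definition eval_even :: "'a::field mpoly \<Rightarrow> 'a" where
  "eval_even p = (\<Sum>x\<in>Poly_Mapping.keys p.
     if \<forall>v. odd v \<longrightarrow> Poly_Mapping.lookup x v = 0 then Poly_Mapping.lookup p x else 0)"

lemma eval_even_0 [simp]: "eval_even 0 = 0"
  by (simp add: eval_even_def)

lemma eval_even_single:
  "eval_even (Poly_Mapping.single x c) = (if \<forall>v. odd v \<longrightarrow> Poly_Mapping.lookup x v = 0 then c else 0)"
proof (cases "c = 0")
  case False
  then have keys: "Poly_Mapping.keys (Poly_Mapping.single x c) = {x}" by simp
  show ?thesis unfolding eval_even_def keys by auto
qed simp

lemma eval_even_plus: "eval_even (p + q) = eval_even p + eval_even q"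
  unfolding eval_even_def by (rule setsum_keys_plus_distrib) auto

lemma eval_even_single_times:
  "eval_even (Poly_Mapping.single x c * q) = eval_even (Poly_Mapping.single x c) * eval_even q"
proof (induction q rule: mpoly_sum_induct)
  case zero
  then show ?case by simp
next
  case (single y d)
  \<comment> \<open>Exponents are natural numbers, so a product of monomials avoids the odd indices
    exactly when both factors do.\<close>
  then show ?case by (auto simp: mult_single eval_even_single lookup_add)
next
  case (add p q)
  then show ?case by (simp only: distrib_left eval_even_plus)
qed

lemma eval_even_times: "eval_even (p * q) = eval_even p * eval_even q"
proof (induction p rule: mpoly_sum_induct)
  case zero
  then show ?case by simp
next
  case (single y d)
  then show ?case by (rule eval_even_single_times)
next
  case (add p q)
  then show ?case by (simp only: distrib_right eval_even_plus)
qed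

lemma eval_even_comm_ring_hom: "comm_ring_hom (eval_even :: 'a::field mpoly \<Rightarrow> 'a)"
  by unfold_locales
     (simp_all add: eval_even_plus eval_even_times eval_even_single flip: single_one)

lemma Fract_1_comm_ring_hom: "comm_ring_hom (\<lambda>p :: 'a::idom. Fract p 1)"
  by unfold_locales (simp_all add: Zero_fract_def One_fract_def)

section \<open>Nonvanishing of the indeterminates and of the determinant\<close>

lemma single_neq_0: "Poly_Mapping.single x (1 :: 'a::zero_neq_one) \<noteq> 0"
  by (metis lookup_single_eq lookup_zero zero_neq_one)

lemma indet_neq_0: "indet v \<noteq> (0 :: 'a::field ratfun)"
proof
  assume "indet v = (0 :: 'a ratfun)"
  then have "Poly_Mapping.single (Poly_Mapping.single v (1 :: nat)) (1 :: 'a) * 1 = 0 * 1"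
    unfolding indet_def Zero_fract_def
    by (rule eq_fract(1)[OF one_neq_zero one_neq_zero, THEN iffD1])
  then show False by (simp only: mult_1_right mult_zero_left single_neq_0)
qed

text \<open>At b_i = 1 and lambda_i = 0 the matrix becomes upper unitriangular, with determinant 1.
  The evaluation is defined on polynomials only, so it is applied to the polynomial matrix
  \<open>M\<close>, whose image in the fraction field is the matrix in question.\<close>

lemma det_tridiag_neq_0: "det (tridiag bvar lvar K) \<noteq> (0 :: 'a::field ratfun)"
proof -
  define x :: "nat \<Rightarrow> 'a mpoly" where "x v = Poly_Mapping.single (Poly_Mapping.single v 1) 1" for v
  define M where "M = tridiag (\<lambda>i. x (2 * i)) (\<lambda>i. x (2 * i - 1)) K"
  interpret ev: comm_ring_hom "eval_even :: 'a mpoly \<Rightarrow> 'a" by (rule eval_even_comm_ring_hom)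
  interpret fr: comm_ring_hom "\<lambda>p :: 'a mpoly. Fract p 1" by (rule Fract_1_comm_ring_hom)
  have ev_x: "eval_even (x v) = (if even v then 1 else 0)" for v
    by (auto simp: x_def eval_even_single lookup_single when_def)
  have M: "M \<in> carrier_mat (Suc K) (Suc K)" by (simp add: M_def)
  \<comment> \<open>On the subdiagonal i >= 1, so 2 * i - 1 is a genuine odd index and the entry
    evaluates to 0.\<close>
  have entry: "map_mat eval_even M $$ (i, j) =
      (if j = i \<or> j = Suc i then 1 else 0)" if "i \<le> K" "j \<le> K" for i j
  proof -
    have "map_mat eval_even M $$ (i, j) = eval_even (M $$ (i, j))" using M that by simp
    then show ?thesis using that by (auto simp: M_def tridiag_index ev_x)
  qed
  have evM: "map_mat eval_even M \<in> carrier_mat (Suc K) (Suc K)" using M by simp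
  have ut: "upper_triangular (map_mat eval_even M)"
    unfolding upper_triangular_def
  proof (intro allI impI)
    fix i j assume "i < dim_row (map_mat eval_even M)" "j < i"
    then have "i \<le> K" "j \<le> K" "j < i" using evM by auto
    then show "map_mat eval_even M $$ (i, j) = 0" by (simp only: entry) simp
  qed
  have "eval_even (det M) = prod_list (diag_mat (map_mat eval_even M))"
    unfolding ev.hom_det[symmetric] by (rule det_upper_triangular[OF ut evM])
  also have "\<dots> = 1"
    unfolding prod_list_diag_prod
  proof (intro prod.neutral ballI)
    fix i assume "i \<in> {0..<dim_row (map_mat eval_even M)}"
    then have "i \<le> K" using evM by auto
    then show "map_mat eval_even M $$ (i, i) = 1" by (simp only: entry) simp
  qed
  finally have "det M \<noteq> 0" by auto
  moreover have "tridiag bvar lvar K = map_mat (\<lambda>p. Fract p 1) M"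
  proof (rule eq_matI)
    fix i j assume "i < dim_row (map_mat (\<lambda>p. Fract p 1) M)" "j < dim_col (map_mat (\<lambda>p. Fract p 1) M)"
    then have ij: "i \<le> K" "j \<le> K" using M by auto
    then have "map_mat (\<lambda>p. Fract p 1) M $$ (i, j) = Fract (M $$ (i, j)) 1" using M by simp
    then show "tridiag bvar lvar K $$ (i, j) = map_mat (\<lambda>p. Fract p 1) M $$ (i, j)"
      using ij by (simp add: M_def tridiag_index bvar_def lvar_def indet_def x_def)
  qed (use M in \<open>auto simp: tridiag_def\<close>)
  then have "det (tridiag bvar lvar K) = Fract (det M) 1" by (simp only: fr.hom_det)
  ultimately show ?thesis
    unfolding Zero_fract_def using eq_fract(1)[OF one_neq_zero one_neq_zero, of "det M" 0] by simp
qed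

text \<open>The indeterminates meet the hypotheses of \<open>hankel_det_reciprocity\<close> with
  \<open>R_op\<close> as the reversing endomorphism. As \<open>m > 0\<close>, the natural
  subtractions of 2 are exact.\<close>

theorem theorem6p1:
  fixes k m n :: nat
  assumes "k > 0" and "m > 0"
  shows "det (mat k k (\<lambda>(i, j).
             moment (bvar :: nat \<Rightarrow> 'a::field ratfun) lvar (k + m - 1)
               (n + i + j + 2 * m - 2))) =
         (\<Prod>i = 1..k + m - 1. lvar i powi (int k - int i)) *
         det (tridiag bvar lvar (k + m - 1)) ^ (n + 2 * m - 2) *
         R_op (k + m - 1) (det (mat m m (\<lambda>(i, j).
             moment_int bvar lvar (k + m - 1) (- int n - int i - int j))))"
proof -
  let ?K = "k + m - 1"
  have b: "R_op ?K (bvar i) = (bvar (?K - i) :: 'a ratfun)" if "i \<le> ?K" for i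
    using that by (rule R_op_bvar)
  have l: "R_op ?K (lvar i) = (lvar (?K + 1 - i) :: 'a ratfun)" if "1 \<le> i" "i \<le> ?K" for i
    using that by (rule R_op_lvar)
  have l0: "lvar i \<noteq> (0 :: 'a ratfun)" for i
    unfolding lvar_def by (rule indet_neq_0)
  show ?thesis
    by (rule hankel_det_reciprocity[where R = "R_op ?K" and b = bvar and l = lvar,
          OF assms R_op_comm_ring_hom b l l0 det_tridiag_neq_0])
qed

end
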